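(* Let $P \in [0,1]^{n\times n}$ be a stochastic matrix with rational entries and let $(X_0,X_1,\dots)$ be a Markov chain on $\{1,\dots,n\}$ with transition matrix $P$. Let $C_1,\dots,C_p$ be its recurrent classes and, for $i \in \{1,\dots,n\}$ and $\ell \in \{1,\dots,p\}$, let $\psi(i,C_\ell)$ be the probability that the chain starting at $i$ reaches $C_\ell$. Then the numbers $(\psi(i,C_\ell))_{i \in [n], \ell \in [p]}$ are rational and their lowest common denominator is not greater than $\min\{D_T, M^{n-2}\}$.
   Context: For each $i$, $M_i$ is the lowest common denominator of the entries of the $i$-th row of $P$; $M$ is the lowest common denominator of all entries of $P$. $T \subset \{1,\dots,n\}$ is the set of transient states of the chain and $D_T \coloneqq \prod_{i \in T} M_i$ (empty product equal to $1$). *)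

theory Defs
  imports "HOL-Analysis.Analysis" "HOL-Probability.Probability"
begin

definition stochastic_matrix :: "real^'n^'n \<Rightarrow> bool" where
  "stochastic_matrix P \<longleftrightarrow>
     (\<forall>i j. P $ i $ j \<in> {0..1}) \<and> (\<forall>i. (\<Sum>j\<in>UNIV. P $ i $ j) = 1)"

text \<open>Meaningful for finite sets of rationals, where such a \<open>d\<close> exists.\<close>

definition lowest_common_denominator :: "real set \<Rightarrow> nat" where
  "lowest_common_denominator A = (LEAST d. d > 0 \<and> (\<forall>x\<in>A. of_nat d * x \<in> \<int>))"

definition markov_chain ::
    "'w measure \<Rightarrow> (nat \<Rightarrow> 'w \<Rightarrow> 'n) \<Rightarrow> real^'n^'n \<Rightarrow> bool" where
  "markov_chain W X P \<longleftrightarrow>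
     prob_space W \<and>
     (\<forall>t. X t \<in> measurable W (count_space UNIV)) \<and>
     (\<forall>t x j. \<P>(\<omega> in W. \<forall>s\<le>t. X s \<omega> = x s) > 0 \<longrightarrow>
        \<P>(\<omega> in W. X (Suc t) \<omega> = j \<bar> \<forall>s\<le>t. X s \<omega> = x s) = P $ x t $ j)"

text \<open>A chain started at every state: \<open>Pr i\<close> is the law under which the process \<open>X\<close> starts at
  \<open>i\<close>. The notions below are relative to such a family of laws.\<close>

definition markov_chain_started_at_each ::
    "('n \<Rightarrow> 'w measure) \<Rightarrow> (nat \<Rightarrow> 'w \<Rightarrow> 'n) \<Rightarrow> real^'n^'n \<Rightarrow> bool" where
  "markov_chain_started_at_each Pr X P \<longleftrightarrow>
     (\<forall>i. markov_chain (Pr i) X P \<and> (AE \<omega> in Pr i. X 0 \<omega> = i))"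

definition return_prob :: "('n \<Rightarrow> 'w measure) \<Rightarrow> (nat \<Rightarrow> 'w \<Rightarrow> 'n) \<Rightarrow> 'n \<Rightarrow> real" where
  "return_prob Pr X i = \<P>(\<omega> in Pr i. \<exists>t\<ge>1. X t \<omega> = i)"

definition recurrent_states :: "('n \<Rightarrow> 'w measure) \<Rightarrow> (nat \<Rightarrow> 'w \<Rightarrow> 'n) \<Rightarrow> 'n set" where
  "recurrent_states Pr X = {i. return_prob Pr X i = 1}"

definition transient_states :: "('n \<Rightarrow> 'w measure) \<Rightarrow> (nat \<Rightarrow> 'w \<Rightarrow> 'n) \<Rightarrow> 'n set" where
  "transient_states Pr X = {i. return_prob Pr X i < 1}"

definition leads_to :: "('n \<Rightarrow> 'w measure) \<Rightarrow> (nat \<Rightarrow> 'w \<Rightarrow> 'n) \<Rightarrow> 'n \<Rightarrow> 'n \<Rightarrow> bool" where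
  "leads_to Pr X i j \<longleftrightarrow> (\<exists>t. \<P>(\<omega> in Pr i. X t \<omega> = j) > 0)"

definition communicating_class :: "('n \<Rightarrow> 'w measure) \<Rightarrow> (nat \<Rightarrow> 'w \<Rightarrow> 'n) \<Rightarrow> 'n \<Rightarrow> 'n set" where
  "communicating_class Pr X i = {j. leads_to Pr X i j \<and> leads_to Pr X j i}"

definition recurrent_classes :: "('n \<Rightarrow> 'w measure) \<Rightarrow> (nat \<Rightarrow> 'w \<Rightarrow> 'n) \<Rightarrow> 'n set set" where
  "recurrent_classes Pr X = communicating_class Pr X ` recurrent_states Pr X"

definition reach_prob :: "('n \<Rightarrow> 'w measure) \<Rightarrow> (nat \<Rightarrow> 'w \<Rightarrow> 'n) \<Rightarrow> 'n \<Rightarrow> 'n set \<Rightarrow> real" where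
  "reach_prob Pr X i C = \<P>(\<omega> in Pr i. \<exists>t. X t \<omega> \<in> C)"

definition row_denominator :: "real^'n^'n \<Rightarrow> 'n \<Rightarrow> nat" where
  "row_denominator P i = lowest_common_denominator {P $ i $ j | j. True}"

definition matrix_denominator :: "real^'n^'n \<Rightarrow> nat" where
  "matrix_denominator P = lowest_common_denominator {P $ i $ j | i j. True}"

end

theory Submission
  imports Defs
begin

text \<open>
  The function \<open>h = \<psi>(\<cdot>, C)\<close> is harmonic on the set \<open>T\<close> of transient states and is the indicator of \<open>C\<close>
  off \<open>T\<close>. Let \<open>A\<close> have the rows of \<open>I - P\<close> in \<open>T\<close> and those of the identity elsewhere. Scaling each
  row \<open>i \<in> T\<close> by \<open>M\<^sub>i\<close> turns the system for \<open>h\<close> into an integral one with determinant \<open>D\<^sub>T det A\<close>, which is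
  a common denominator of all values of \<open>h\<close> by Cramer's rule. The minimum principle gives
  \<open>0 < det A \<le> 1\<close>: switching the rows of the identity to rows of \<open>I - P\<close> one at a time multiplies the
  determinant by an escape probability at each step.

  If there are at least two recurrent states, then \<open>D\<^sub>T \<le> M\<^bsup>|T|\<^esup> \<le> M\<^bsup>n-2\<^esup>\<close>. Otherwise the unique
  recurrent state is reached almost surely and every \<open>\<psi>\<close> is \<open>1\<close>.
\<close>

section \<open>The transition graph and the minimum principle\<close>

definition edges :: "real^'n^'n \<Rightarrow> ('n \<times> 'n) set" where
  "edges P = {(i, j). P $ i $ j > 0}"

lemma stochastic_nonneg: "stochastic_matrix P \<Longrightarrow> 0 \<le> P $ i $ j"
  by (auto simp: stochastic_matrix_def)

lemma stochastic_row_sum: "stochastic_matrix P \<Longrightarrow> (\<Sum>j\<in>UNIV. P $ i $ j) = 1"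
  by (auto simp: stochastic_matrix_def)

lemma stochastic_nonedge:
  assumes "stochastic_matrix P" "(i, j) \<notin> edges P"
  shows "P $ i $ j = 0"
  using assms stochastic_nonneg[OF assms(1), of i j] by (auto simp: edges_def)

text \<open>Row \<open>i\<close> sums to 1, so the terms \<open>P $ i $ j * (g j - m)\<close> sum to
  0; none is negative, hence each vanishes.\<close>

lemma average_at_lower_bound:
  fixes P :: "real^'n^'n"
  assumes st: "stochastic_matrix P"
    and avg: "(\<Sum>j\<in>UNIV. P $ i $ j * g j) = m"
    and lb: "\<And>j. (i, j) \<in> edges P \<Longrightarrow> m \<le> g j"
    and e: "(i, j) \<in> edges P"
  shows "g j = m"
proof -
  have "(\<Sum>j\<in>UNIV. P $ i $ j * (g j - m)) = m - (\<Sum>j\<in>UNIV. P $ i $ j) * m"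
    by (simp add: avg[symmetric] sum_distrib_right sum_subtractf right_diff_distrib)
  also have "\<dots> = 0"
    by (simp add: stochastic_row_sum[OF st])
  finally have "(\<Sum>j\<in>UNIV. P $ i $ j * (g j - m)) = 0" .
  moreover have "0 \<le> P $ i $ k * (g k - m)" for k
  proof (cases "(i, k) \<in> edges P")
    case True
    then show ?thesis using lb[OF True] stochastic_nonneg[OF st] by simp
  next
    case False
    then show ?thesis by (simp add: stochastic_nonedge[OF st])
  qed
  ultimately have "P $ i $ j * (g j - m) = 0"
    by (simp add: sum_nonneg_eq_0_iff)
  then show ?thesis using e by (auto simp: edges_def)
qed

text \<open>Minimum principle: a minimum of \<open>g\<close> over \<open>S\<close> below
  \<open>c\<close> would spread along edges and never meet \<open>C\<close>, although
  \<open>C\<close> is reachable. A general \<open>S\<close> covers both the whole state space and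
  the successors of one state.\<close>

lemma harmonic_ge_boundary:
  fixes P :: "real^'n^'n"
  assumes st: "stochastic_matrix P"
    and closed: "\<And>i j. i \<in> S \<Longrightarrow> i \<notin> C \<Longrightarrow> (i, j) \<in> edges P \<Longrightarrow> j \<in> S"
    and harm: "\<And>i. i \<in> S \<Longrightarrow> i \<notin> C \<Longrightarrow> g i = (\<Sum>j\<in>UNIV. P $ i $ j * g j)"
    and bdry: "\<And>i. i \<in> S \<Longrightarrow> i \<in> C \<Longrightarrow> c \<le> g i"
    and reach: "\<And>i. i \<in> S \<Longrightarrow> \<exists>k\<in>C. (i, k) \<in> (edges P)\<^sup>*"
    and "i \<in> S"
  shows "c \<le> g i"
proof -
  define m where "m = Min (g ` S)"
  have "m \<in> g ` S" unfolding m_def using \<open>i \<in> S\<close> by (intro Min_in) auto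
  then obtain k where k: "k \<in> S" "g k = m" by auto
  have m_le: "m \<le> g j" if "j \<in> S" for j using that by (simp add: m_def)
  have "c \<le> m"
  proof (rule ccontr)
    assume "\<not> c \<le> m"
    \<comment> \<open>As \<open>m < c\<close>, no state of \<open>S\<close> with value
      \<open>m\<close> lies in \<open>C\<close>; so \<open>g\<close> is harmonic there and the value
      passes on to all successors.\<close>
    have "l \<in> S \<and> g l = m" if "(k, l) \<in> (edges P)\<^sup>*" for l
      using that
    proof (induction rule: rtrancl_induct)
      case base
      show ?case using k by simp
    next
      case (step y z)
      have "y \<notin> C" using step.IH bdry[of y] \<open>\<not> c \<le> m\<close> by auto
      have "z \<in> S" using closed step.IH \<open>y \<notin> C\<close> step.hyps(2) by blast
      moreover have "g z = m"
      proof (rule average_at_lower_bound[OF st _ _ step.hyps(2)])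
        show "(\<Sum>j\<in>UNIV. P $ y $ j * g j) = m"
          using harm[of y] step.IH \<open>y \<notin> C\<close> by simp
        show "m \<le> g j" if "(y, j) \<in> edges P" for j
          using closed[OF _ \<open>y \<notin> C\<close> that] step.IH m_le by blast
      qed
      ultimately show ?case by simp
    qed
    moreover obtain l where "l \<in> C" "(k, l) \<in> (edges P)\<^sup>*"
      using reach[OF k(1)] by blast
    ultimately show False using bdry[of l] \<open>\<not> c \<le> m\<close> by auto
  qed
  then show ?thesis using m_le[OF \<open>i \<in> S\<close>] by simp
qed


subsection \<open>Determinants of absorbing systems\<close>

text \<open>The Dirichlet problem on \<open>S\<close>: for a function \<open>v\<close> that is harmonic on \<open>S\<close>, the product of this
  matrix with \<open>v\<close> vanishes on \<open>S\<close> and equals \<open>v\<close> off \<open>S\<close>.\<close>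

definition dirichlet_matrix :: "real^'n^'n \<Rightarrow> 'n set \<Rightarrow> real^'n^'n" where
  "dirichlet_matrix P S = (\<chi> i j. (if i = j then 1 else 0) - (if i \<in> S then P $ i $ j else 0))"

lemma dirichlet_matrix_vector:
  fixes P :: "real^'n^'n"
  shows "(dirichlet_matrix P S *v v) $ i =
    (if i \<in> S then v $ i - (\<Sum>j\<in>UNIV. P $ i $ j * v $ j) else v $ i)"
proof -
  have "(dirichlet_matrix P S *v v) $ i =
    (\<Sum>j\<in>UNIV. (if i = j then v $ j else 0) - (if i \<in> S then P $ i $ j * v $ j else 0))"
    unfolding dirichlet_matrix_def matrix_vector_mult_def
    by (auto intro!: sum.cong simp: left_diff_distrib)
  then show ?thesis by (simp add: sum_subtractf)
qed

context
  fixes P :: "real^'n^'n" and S :: "'n set"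
  assumes st: "stochastic_matrix P"
    and exit: "\<And>i. \<exists>k. k \<notin> S \<and> (i, k) \<in> (edges P)\<^sup>*"
begin

lemma dirichlet_ge:
  assumes "\<And>i. i \<in> S \<Longrightarrow> g i = (\<Sum>j\<in>UNIV. P $ i $ j * g j)"
    and "\<And>i. i \<notin> S \<Longrightarrow> c \<le> g i"
  shows "c \<le> g i"
  by (rule harmonic_ge_boundary[OF st, where S = UNIV and C = "- S"])
    (use assms exit in \<open>auto simp: Bex_def\<close>)

lemma dirichlet_le:
  assumes "\<And>i. i \<in> S \<Longrightarrow> g i = (\<Sum>j\<in>UNIV. P $ i $ j * g j)"
    and "\<And>i. i \<notin> S \<Longrightarrow> g i \<le> c"
  shows "g i \<le> c"
  using dirichlet_ge[of "\<lambda>i. - g i" "- c" i] assms by (simp add: sum_negf)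

text \<open>A kernel vector is harmonic on \<open>S\<close> and zero off it, so the minimum and
  maximum principles squeeze it to zero.\<close>

lemma invertible_dirichlet_matrix: "invertible (dirichlet_matrix P S)"
proof -
  have "v = 0" if "dirichlet_matrix P S *v v = 0" for v
  proof -
    have eq: "(dirichlet_matrix P S *v v) $ i = 0" for i using that by simp
    have harm: "v $ i = (\<Sum>j\<in>UNIV. P $ i $ j * v $ j)" if "i \<in> S" for i
      using eq[of i] that by (simp add: dirichlet_matrix_vector)
    have zero: "v $ i = 0" if "i \<notin> S" for i
      using eq[of i] that by (simp add: dirichlet_matrix_vector)
    have "0 \<le> v $ i" for i
      by (rule dirichlet_ge[where g = "\<lambda>i. v $ i"]) (auto simp: zero intro: harm)
    moreover have "v $ i \<le> 0" for i
      by (rule dirichlet_le[where g = "\<lambda>i. v $ i"]) (auto simp: zero intro: harm)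
    ultimately show ?thesis by (simp add: vec_eq_iff order_antisym)
  qed
  then show ?thesis
    by (simp add: invertible_left_inverse matrix_left_invertible_ker)
qed

text \<open>By Cramer's rule the ratio of the two determinants is \<open>1 - (P v) k\<close>, where \<open>v\<close> solves the Dirichlet
  problem on \<open>S\<close> with boundary value \<open>1\<close> at \<open>k\<close> and \<open>0\<close> elsewhere, so that \<open>0 \<le> v \<le> 1\<close>.\<close>

lemma det_dirichlet_insert:
  assumes "k \<notin> S"
  obtains c where "0 \<le> c" "c \<le> 1"
    and "det (dirichlet_matrix P (insert k S)) = c * det (dirichlet_matrix P S)"
proof -
  let ?A = "dirichlet_matrix P S" and ?B = "dirichlet_matrix P (insert k S)"
  obtain A' where A': "?A ** A' = mat 1" "A' ** ?A = mat 1"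
    using invertible_dirichlet_matrix unfolding invertible_def by blast
  \<comment> \<open>\<open>v\<close> is column \<open>k\<close> of the inverse; \<open>w\<close>
    holds the coordinates of row \<open>k\<close> of \<open>?B\<close> in the rows of
    \<open>?A\<close>.\<close>
  define v where "v = A' *v axis k 1"
  define w where "w = row k ?B v* A'"
  have Av: "?A *v v = axis k 1"
    by (simp add: v_def matrix_vector_mul_assoc A')
  have wA: "w v* ?A = row k ?B"
    by (simp add: w_def vector_matrix_mul_assoc A')
  have v_S: "v $ i = (\<Sum>j\<in>UNIV. P $ i $ j * v $ j)" if "i \<in> S" for i
    using arg_cong[OF Av, of "\<lambda>x. x $ i"] that assms
    by (auto simp: dirichlet_matrix_vector axis_def split: if_splits)
  have v_notS: "v $ i = (if i = k then 1 else 0)" if "i \<notin> S" for i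
    using arg_cong[OF Av, of "\<lambda>x. x $ i"] that
    by (auto simp: dirichlet_matrix_vector axis_def)
  have v_ge: "0 \<le> v $ i" for i
    by (rule dirichlet_ge[where g = "\<lambda>i. v $ i"]) (auto simp: v_notS intro: v_S)
  have v_le: "v $ i \<le> 1" for i
    by (rule dirichlet_le[where g = "\<lambda>i. v $ i"]) (auto simp: v_notS intro: v_S)
  \<comment> \<open>Moving \<open>?A\<close> across the inner product evaluates \<open>w $ k\<close>
    as row \<open>k\<close> of \<open>?B\<close> paired with \<open>v\<close>.\<close>
  have "w $ k = w \<bullet> (?A *v v)"
    by (simp add: Av inner_axis)
  also have "\<dots> = (w v* ?A) \<bullet> v"
    by (metis dot_lmul_matrix)
  also have "\<dots> = (?B *v v) $ k"
    by (simp add: wA row_def inner_vec_def matrix_vector_mult_def)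
  also have "\<dots> = 1 - (\<Sum>j\<in>UNIV. P $ k $ j * v $ j)"
    using assms by (simp add: dirichlet_matrix_vector v_notS)
  finally have wk: "w $ k = 1 - (\<Sum>j\<in>UNIV. P $ k $ j * v $ j)" .
  have "0 \<le> (\<Sum>j\<in>UNIV. P $ k $ j * v $ j)"
    by (intro sum_nonneg mult_nonneg_nonneg stochastic_nonneg st v_ge)
  then have "w $ k \<le> 1" by (simp add: wk)
  have "(\<Sum>j\<in>UNIV. P $ k $ j * v $ j) \<le> (\<Sum>j\<in>UNIV. P $ k $ j)"
    by (intro sum_mono mult_left_le stochastic_nonneg st v_le)
  then have "0 \<le> w $ k" by (simp add: wk stochastic_row_sum[OF st])
  have comb: "(\<Sum>i\<in>UNIV. w $ i *s row i ?A) = row k ?B"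
    unfolding wA[symmetric]
    by (simp add: vec_eq_iff vector_matrix_mult_def row_def mult.commute)
  \<comment> \<open>\<open>?B\<close> differs from \<open>?A\<close> only in row \<open>k\<close>,
    so Cramer's rule for rows leaves the factor \<open>w $ k\<close>.\<close>
  have "?B = (\<chi> i. if i = k then \<Sum>i\<in>UNIV. w $ i *s row i ?A else row i ?A)"
    unfolding comb by (auto simp: vec_eq_iff row_def dirichlet_matrix_def)
  then have "det ?B = w $ k * det ?A"
    using cramer_lemma_transpose[where x = w and A = ?A and k = k] by simp
  then show ?thesis using that \<open>0 \<le> w $ k\<close> \<open>w $ k \<le> 1\<close> by blast
qed

end

lemma det_dirichlet_matrix_le_1:
  fixes P :: "real^'n^'n"
  assumes st: "stochastic_matrix P"
    and exit: "\<And>i. \<exists>k. k \<notin> S \<and> (i, k) \<in> (edges P)\<^sup>*"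
  shows "0 < det (dirichlet_matrix P S)" "det (dirichlet_matrix P S) \<le> 1"
proof -
  \<comment> \<open>Subsets inherit \<open>exit\<close> because their complements are larger. The
    factors are only known to be nonnegative, so the induction gives \<open>0 \<le>\<close>;
    invertibility makes it strict at the end.\<close>
  have "0 \<le> det (dirichlet_matrix P S') \<and> det (dirichlet_matrix P S') \<le> 1" if "S' \<subseteq> S" for S'
    using finite[of S'] that
  proof (induction S' rule: finite_induct)
    case empty
    have "dirichlet_matrix P {} = mat 1"
      by (simp add: dirichlet_matrix_def mat_def)
    then show ?case by simp
  next
    case (insert k F)
    have "\<exists>k. k \<notin> F \<and> (i, k) \<in> (edges P)\<^sup>*" for i
      using exit[of i] insert.prems by blast
    from det_dirichlet_insert[OF st this insert.hyps(2)] obtain c where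
      "0 \<le> c" "c \<le> 1"
      "det (dirichlet_matrix P (insert k F)) = c * det (dirichlet_matrix P F)" .
    then show ?case using insert.IH insert.prems by (simp add: mult_le_one)
  qed
  then have *: "0 \<le> det (dirichlet_matrix P S)" "det (dirichlet_matrix P S) \<le> 1" by auto
  show "det (dirichlet_matrix P S) \<le> 1" by (rule *)
  show "0 < det (dirichlet_matrix P S)"
    using * invertible_dirichlet_matrix[OF st exit] by (simp add: invertible_det_nz order_less_le)
qed


subsection \<open>First-step analysis\<close>

locale markov_family =
  fixes P :: "real^'n^'n"
    and Pr :: "'n \<Rightarrow> 'w measure"
    and X :: "nat \<Rightarrow> 'w \<Rightarrow> 'n"
  assumes st: "stochastic_matrix P"
    and chain: "markov_chain_started_at_each Pr X P"
begin

lemma prob_space_Pr: "prob_space (Pr i)"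
  using chain by (auto simp: markov_chain_started_at_each_def markov_chain_def)

sublocale law: prob_space "Pr i" for i
  by (rule prob_space_Pr)

lemma measurable_X [measurable]: "X t \<in> measurable (Pr i) (count_space UNIV)"
  using chain by (auto simp: markov_chain_started_at_each_def markov_chain_def)

lemma AE_start: "AE \<omega> in Pr i. X 0 \<omega> = i"
  using chain by (auto simp: markov_chain_started_at_each_def)

lemma prob_path:
  "\<P>(\<omega> in Pr i. \<forall>s\<le>t. X s \<omega> = x s) =
    (if x 0 = i then 1 else 0) * (\<Prod>s<t. P $ x s $ x (Suc s))"
proof (induction t)
  case 0
  show ?case
  proof (cases "x 0 = i")
    case True
    then have "\<P>(\<omega> in Pr i. X 0 \<omega> = x 0) = 1"
      using AE_start[of i] by (subst law.prob_Collect_eq_1) auto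
    then show ?thesis using True by simp
  next
    case False
    then have "\<P>(\<omega> in Pr i. X 0 \<omega> = x 0) = 0"
      using AE_start[of i] by (subst law.prob_Collect_eq_0) auto
    then show ?thesis using False by simp
  qed
next
  case (Suc t)
  have split: "(\<forall>s\<le>Suc t. X s \<omega> = x s) \<longleftrightarrow> X (Suc t) \<omega> = x (Suc t) \<and> (\<forall>s\<le>t. X s \<omega> = x s)" for \<omega>
    by (auto simp: le_Suc_eq)
  show ?case
  proof (cases "\<P>(\<omega> in Pr i. \<forall>s\<le>t. X s \<omega> = x s) > 0")
    case True
    then have "\<P>(\<omega> in Pr i. X (Suc t) \<omega> = x (Suc t) \<bar> \<forall>s\<le>t. X s \<omega> = x s) = P $ x t $ x (Suc t)"
      using chain by (auto simp: markov_chain_started_at_each_def markov_chain_def)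
    then have "\<P>(\<omega> in Pr i. X (Suc t) \<omega> = x (Suc t) \<and> (\<forall>s\<le>t. X s \<omega> = x s)) =
      P $ x t $ x (Suc t) * \<P>(\<omega> in Pr i. \<forall>s\<le>t. X s \<omega> = x s)"
      using True by (simp add: cond_prob_def field_simps)
    then show ?thesis by (simp only: split Suc.IH) simp
  next
    \<comment> \<open>A null history leaves the conditional probability unconstrained, but the
      longer event is then null too, and the induction hypothesis makes the product vanish.\<close>
    case False
    then have zero: "\<P>(\<omega> in Pr i. \<forall>s\<le>t. X s \<omega> = x s) = 0"
      by (simp add: zero_less_measure_iff)
    have "\<P>(\<omega> in Pr i. \<forall>s\<le>Suc t. X s \<omega> = x s) \<le> \<P>(\<omega> in Pr i. \<forall>s\<le>t. X s \<omega> = x s)"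
      by (rule law.finite_measure_mono) auto
    then have "\<P>(\<omega> in Pr i. \<forall>s\<le>Suc t. X s \<omega> = x s) = 0"
      using zero by (simp add: measure_le_0_iff)
    then show ?thesis using zero by (simp only: Suc.IH) (auto split: if_splits)
  qed
qed

text \<open>The law of the first \<open>Suc t\<close> states, so \<open>t\<close> counts
  transitions. With lists, events on finite prefixes become finite sums and prepending a state is
  \<open>#\<close>.\<close>

definition path_prob :: "'n \<Rightarrow> nat \<Rightarrow> 'n list set \<Rightarrow> real" where
  "path_prob i t A = \<P>(\<omega> in Pr i. map (\<lambda>s. X s \<omega>) [0..<Suc t] \<in> A)"

lemma finite_lists_of_length: "finite {xs :: 'n list. length xs = t \<and> xs \<in> A}"
  by (rule finite_subset[OF _ finite_lists_length_eq[of UNIV t]]) auto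

lemma path_prob_eq_sum:
  "path_prob i t A = (\<Sum>xs | length xs = Suc t \<and> xs \<in> A.
     (if xs ! 0 = i then 1 else 0) * (\<Prod>s<t. P $ (xs ! s) $ (xs ! Suc s)))"
proof -
  have path_eq: "map (\<lambda>s. X s \<omega>) [0..<Suc t] = xs \<longleftrightarrow> (\<forall>s\<le>t. X s \<omega> = xs ! s)"
    if "length xs = Suc t" for \<omega> xs
    using that by (auto simp: list_eq_iff_nth_eq less_Suc_eq_le simp del: upt_Suc)
  let ?I = "{xs. length xs = Suc t \<and> xs \<in> A}"
  let ?E = "\<lambda>xs. {\<omega> \<in> space (Pr i). \<forall>s\<le>t. X s \<omega> = xs ! s}"
  have "{\<omega> \<in> space (Pr i). map (\<lambda>s. X s \<omega>) [0..<Suc t] \<in> A} = (\<Union>xs\<in>?I. ?E xs)"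
  proof (intro set_eqI iffI)
    fix \<omega> assume "\<omega> \<in> {\<omega> \<in> space (Pr i). map (\<lambda>s. X s \<omega>) [0..<Suc t] \<in> A}"
    then show "\<omega> \<in> (\<Union>xs\<in>?I. ?E xs)"
      by (intro UN_I[of "map (\<lambda>s. X s \<omega>) [0..<Suc t]"])
        (auto simp: nth_append less_Suc_eq_le simp del: upt_Suc)
  next
    fix \<omega> assume "\<omega> \<in> (\<Union>xs\<in>?I. ?E xs)"
    then obtain xs where xs: "length xs = Suc t" "xs \<in> A" "\<omega> \<in> ?E xs" by auto
    then show "\<omega> \<in> {\<omega> \<in> space (Pr i). map (\<lambda>s. X s \<omega>) [0..<Suc t] \<in> A}"
      using path_eq[OF xs(1), of \<omega>] by (auto simp del: upt_Suc)
  qed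
  then have "path_prob i t A = measure (Pr i) (\<Union>xs\<in>?I. ?E xs)"
    by (simp add: path_prob_def del: upt_Suc)
  also have "\<dots> = (\<Sum>xs\<in>?I. measure (Pr i) (?E xs))"
  proof (rule law.finite_measure_finite_Union)
    show "finite ?I" by (rule finite_lists_of_length)
    show "?E ` ?I \<subseteq> sets (Pr i)" by auto
    show "disjoint_family_on ?E ?I"
      unfolding disjoint_family_on_def
    proof (intro ballI impI)
      fix xs ys assume *: "xs \<in> ?I" "ys \<in> ?I" "xs \<noteq> ys"
      have "\<not> (\<omega> \<in> ?E xs \<and> \<omega> \<in> ?E ys)" for \<omega>
        using path_eq[of xs \<omega>] path_eq[of ys \<omega>] * by auto
      then show "?E xs \<inter> ?E ys = {}" by blast
    qed
  qed
  also have "\<dots> = (\<Sum>xs\<in>?I. (if xs ! 0 = i then 1 else 0) * (\<Prod>s<t. P $ (xs ! s) $ (xs ! Suc s)))"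
    by (intro sum.cong refl) (rule prob_path)
  finally show ?thesis .
qed

text \<open>The weight of a path factors into its first transition and the weight of its tail, a
  path of the chain started at \<open>j\<close>. This is the Markov property at time 1, read off
  from \<open>prob_path\<close>.\<close>

lemma path_prob_Suc:
  "path_prob i (Suc t) A = (\<Sum>j\<in>UNIV. P $ i $ j * path_prob j t {ys. i # ys \<in> A})"
proof -
  let ?w = "\<lambda>t (xs :: 'n list). \<Prod>s<t. P $ (xs ! s) $ (xs ! Suc s)"
  let ?J = "{ys. length ys = Suc t \<and> ys \<in> {ys. i # ys \<in> A}}"
  \<comment> \<open>Paths that do not start at \<open>i\<close> have weight 0; the others are
    indexed by their tails.\<close>
  have "path_prob i (Suc t) A = (\<Sum>xs\<in>(#) i ` ?J. ?w (Suc t) xs)"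
    unfolding path_prob_eq_sum
  proof (rule sum.mono_neutral_cong_right)
    show "\<forall>xs\<in>{xs. length xs = Suc (Suc t) \<and> xs \<in> A} - (#) i ` ?J.
        (if xs ! 0 = i then 1 else 0) * ?w (Suc t) xs = 0"
    proof
      fix xs assume xs: "xs \<in> {xs. length xs = Suc (Suc t) \<and> xs \<in> A} - (#) i ` ?J"
      then obtain x ys where "xs = x # ys" "length ys = Suc t" by (auto simp: length_Suc_conv)
      then have "x \<noteq> i" using xs by auto
      then show "(if xs ! 0 = i then 1 else 0) * ?w (Suc t) xs = 0" using \<open>xs = x # ys\<close> by simp
    qed
  qed (use finite_lists_of_length[of "Suc (Suc t)" A] in auto)
  also have "\<dots> = (\<Sum>ys\<in>?J. ?w (Suc t) (i # ys))"
    by (subst sum.reindex) (auto simp: inj_on_def)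
  also have "\<dots> = (\<Sum>ys\<in>?J. P $ i $ (ys ! 0) * ?w t ys)"
    by (subst prod.lessThan_Suc_shift) simp
  \<comment> \<open>Only \<open>j = ys ! 0\<close> survives in the inserted sum, whose terms now
    match the weights of \<open>path_prob j t\<close>.\<close>
  also have "\<dots> = (\<Sum>ys\<in>?J. \<Sum>j\<in>UNIV. P $ i $ j * ((if ys ! 0 = j then 1 else 0) * ?w t ys))"
  proof (intro sum.cong refl)
    fix ys
    have "(\<Sum>j\<in>UNIV. P $ i $ j * ((if ys ! 0 = j then 1 else 0) * ?w t ys)) =
      (\<Sum>j\<in>UNIV. if ys ! 0 = j then P $ i $ j * ?w t ys else 0)"
      by (intro sum.cong) auto
    then show "P $ i $ (ys ! 0) * ?w t ys =
        (\<Sum>j\<in>UNIV. P $ i $ j * ((if ys ! 0 = j then 1 else 0) * ?w t ys))"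
      by simp
  qed
  also have "\<dots> = (\<Sum>j\<in>UNIV. P $ i $ j * path_prob j t {ys. i # ys \<in> A})"
    unfolding path_prob_eq_sum by (subst sum.swap) (simp add: sum_distrib_left)
  finally show ?thesis .
qed

text \<open>A finite-horizon version of \<open>reach_prob\<close>: it depends on a path prefix, so
  it obeys the first-step recursion, which is then passed to the limit.\<close>

definition reach_by :: "nat \<Rightarrow> 'n \<Rightarrow> 'n set \<Rightarrow> real" where
  "reach_by t i C = \<P>(\<omega> in Pr i. \<exists>s\<le>t. X s \<omega> \<in> C)"

lemma reach_by_eq_path_prob: "reach_by t i C = path_prob i t {xs. set xs \<inter> C \<noteq> {}}"
proof -
  have "(\<exists>s\<le>t. X s \<omega> \<in> C) \<longleftrightarrow> map (\<lambda>s. X s \<omega>) [0..<Suc t] \<in> {xs. set xs \<inter> C \<noteq> {}}" for \<omega>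
    by (force simp: less_Suc_eq_le atLeast0LessThan simp del: upt_Suc)
  then show ?thesis unfolding reach_by_def path_prob_def by presburger
qed

lemma reach_by_start: "i \<in> C \<Longrightarrow> reach_by t i C = 1"
  unfolding reach_by_def using AE_start[of i] by (subst law.prob_Collect_eq_1) auto

lemma reach_by_0: "i \<notin> C \<Longrightarrow> reach_by 0 i C = 0"
  unfolding reach_by_def using AE_start[of i] by (subst law.prob_Collect_eq_0) auto

lemma reach_by_Suc:
  assumes "i \<notin> C"
  shows "reach_by (Suc t) i C = (\<Sum>j\<in>UNIV. P $ i $ j * reach_by t j C)"
  unfolding reach_by_eq_path_prob path_prob_Suc using assms by simp

lemma reach_by_limit: "(\<lambda>t. reach_by t i C) \<longlonglongrightarrow> reach_prob Pr X i C"
proof -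
  have "(\<lambda>t. measure (Pr i) {\<omega> \<in> space (Pr i). \<exists>s\<le>t. X s \<omega> \<in> C}) \<longlonglongrightarrow>
      measure (Pr i) (\<Union>t. {\<omega> \<in> space (Pr i). \<exists>s\<le>t. X s \<omega> \<in> C})"
    by (rule law.finite_Lim_measure_incseq) (auto simp: incseq_def intro: order_trans)
  also have "(\<Union>t. {\<omega> \<in> space (Pr i). \<exists>s\<le>t. X s \<omega> \<in> C}) = {\<omega> \<in> space (Pr i). \<exists>t. X t \<omega> \<in> C}"
    by auto
  finally show ?thesis unfolding reach_by_def reach_prob_def .
qed

lemma reach_prob_le_1: "reach_prob Pr X i C \<le> 1"
  by (simp add: reach_prob_def)

lemma reach_prob_start:
  assumes "i \<in> C" shows "reach_prob Pr X i C = 1"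
  using reach_by_limit[of i C] assms by (simp add: reach_by_start LIMSEQ_const_iff)

lemma reach_prob_harmonic:
  assumes "i \<notin> C"
  shows "reach_prob Pr X i C = (\<Sum>j\<in>UNIV. P $ i $ j * reach_prob Pr X j C)"
proof (rule LIMSEQ_unique)
  show "(\<lambda>t. reach_by (Suc t) i C) \<longlonglongrightarrow> reach_prob Pr X i C"
    by (rule LIMSEQ_Suc[OF reach_by_limit])
  show "(\<lambda>t. reach_by (Suc t) i C) \<longlonglongrightarrow> (\<Sum>j\<in>UNIV. P $ i $ j * reach_prob Pr X j C)"
    unfolding reach_by_Suc[OF assms] by (intro tendsto_intros reach_by_limit)
qed

text \<open>Unlike hitting \<open>{i}\<close>, a return disregards time 0: one step is taken first,
  then \<open>i\<close> is hit from the new state.\<close>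

lemma return_prob_eq: "return_prob Pr X i = (\<Sum>j\<in>UNIV. P $ i $ j * reach_prob Pr X j {i})"
proof (rule LIMSEQ_unique)
  let ?R = "\<lambda>t. \<P>(\<omega> in Pr i. \<exists>s\<le>Suc t. 1 \<le> s \<and> X s \<omega> = i)"
  have "?R \<longlonglongrightarrow> measure (Pr i) (\<Union>t. {\<omega> \<in> space (Pr i). \<exists>s\<le>Suc t. 1 \<le> s \<and> X s \<omega> = i})"
    by (rule law.finite_Lim_measure_incseq) (auto simp: incseq_def intro: order_trans)
  also have "(\<Union>t. {\<omega> \<in> space (Pr i). \<exists>s\<le>Suc t. 1 \<le> s \<and> X s \<omega> = i}) =
      {\<omega> \<in> space (Pr i). \<exists>t\<ge>1. X t \<omega> = i}"
    by (auto intro: le_SucI)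
  finally show "?R \<longlonglongrightarrow> return_prob Pr X i" unfolding return_prob_def .
  \<comment> \<open>\<open>tl\<close> drops time 0, so a return within \<open>Suc t\<close> steps
    becomes hitting \<open>i\<close> within \<open>t\<close> steps after the first one.\<close>
  have "(\<exists>s\<le>Suc t. 1 \<le> s \<and> X s \<omega> = i) \<longleftrightarrow>
      map (\<lambda>s. X s \<omega>) [0..<Suc (Suc t)] \<in> {xs. i \<in> set (tl xs)}" for t \<omega>
  proof -
    have "tl (map (\<lambda>s. X s \<omega>) [0..<Suc (Suc t)]) = map (\<lambda>s. X s \<omega>) [1..<Suc (Suc t)]"
      by (simp only: map_tl[symmetric] tl_upt One_nat_def)
    moreover have "set [1..<Suc (Suc t)] = {s. 1 \<le> s \<and> s \<le> Suc t}"
      unfolding set_upt by auto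
    ultimately show ?thesis by (auto simp del: upt_Suc)
  qed
  then have "?R t = path_prob i (Suc t) {xs. i \<in> set (tl xs)}" for t
    unfolding path_prob_def by presburger
  then have "?R t = (\<Sum>j\<in>UNIV. P $ i $ j * reach_by t j {i})" for t
    by (simp add: path_prob_Suc reach_by_eq_path_prob)
  then show "?R \<longlonglongrightarrow> (\<Sum>j\<in>UNIV. P $ i $ j * reach_prob Pr X j {i})"
    by (simp only:) (intro tendsto_intros reach_by_limit)
qed

text \<open>A positive limit has a positive finite-horizon term, and induction on the horizon traces
  a path. Conversely, harmonicity pulls positivity back along a path from its end in
  \<open>C\<close>.\<close>

lemma reach_prob_pos_iff:
  "0 < reach_prob Pr X i C \<longleftrightarrow> (\<exists>k\<in>C. (i, k) \<in> (edges P)\<^sup>*)"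
proof
  assume "0 < reach_prob Pr X i C"
  then have "eventually (\<lambda>t. 0 < reach_by t i C) sequentially"
    using reach_by_limit by (rule order_tendstoD(1)[rotated])
  then obtain t where "0 < reach_by t i C"
    by (auto simp: eventually_sequentially)
  then show "\<exists>k\<in>C. (i, k) \<in> (edges P)\<^sup>*"
  proof (induction t arbitrary: i)
    case 0
    then have "i \<in> C" using reach_by_0[of i C] by force
    then show ?case by blast
  next
    case (Suc t)
    show ?case
    proof (cases "i \<in> C")
      case False
      then have "0 < (\<Sum>j\<in>UNIV. P $ i $ j * reach_by t j C)"
        using Suc.prems by (simp add: reach_by_Suc)
      then obtain j where "0 < P $ i $ j * reach_by t j C"
        using sum_nonpos[of UNIV "\<lambda>j. P $ i $ j * reach_by t j C"] by (meson not_le)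
      then have "0 < P $ i $ j" "0 < reach_by t j C"
        using stochastic_nonneg[OF st, of i j] by (auto simp: zero_less_mult_iff)
      then show ?thesis
        using Suc.IH[of j] by (auto simp: edges_def intro: converse_rtrancl_into_rtrancl)
    qed blast
  qed
next
  assume "\<exists>k\<in>C. (i, k) \<in> (edges P)\<^sup>*"
  then obtain k where "(i, k) \<in> (edges P)\<^sup>*" "k \<in> C" by blast
  then show "0 < reach_prob Pr X i C"
  proof (induction rule: converse_rtrancl_induct)
    case base
    then show ?case by (simp add: reach_prob_start)
  next
    case (step y z)
    show ?case
    proof (cases "y \<in> C")
      case True
      then show ?thesis by (simp add: reach_prob_start)
    next
      case False
      have "0 < P $ y $ z * reach_prob Pr X z C"
        using step by (auto simp: edges_def)
      also have "\<dots> \<le> (\<Sum>j\<in>UNIV. P $ y $ j * reach_prob Pr X j C)"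
        by (rule member_le_sum) (auto simp: stochastic_nonneg[OF st] reach_prob_def)
      finally show ?thesis by (simp add: reach_prob_harmonic[OF False])
    qed
  qed
qed

text \<open>The hitting event is a countable union over times, so it has positive probability
  exactly if some single time does.\<close>

lemma leads_to_iff: "leads_to Pr X i j \<longleftrightarrow> (i, j) \<in> (edges P)\<^sup>*"
proof -
  have "leads_to Pr X i j \<longleftrightarrow> 0 < reach_prob Pr X i {j}"
  proof
    assume "leads_to Pr X i j"
    then obtain t where "0 < \<P>(\<omega> in Pr i. X t \<omega> = j)" by (auto simp: leads_to_def)
    also have "\<dots> \<le> reach_prob Pr X i {j}"
      unfolding reach_prob_def by (rule law.finite_measure_mono) auto
    finally show "0 < reach_prob Pr X i {j}" .
  next
    assume pos: "0 < reach_prob Pr X i {j}"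
    show "leads_to Pr X i j"
    proof (rule ccontr)
      assume "\<not> leads_to Pr X i j"
      then have "\<P>(\<omega> in Pr i. X t \<omega> = j) = 0" for t
        by (simp add: leads_to_def zero_less_measure_iff)
      then have "AE \<omega> in Pr i. X t \<omega> \<noteq> j" for t
        by (subst (asm) law.prob_Collect_eq_0) auto
      then have "AE \<omega> in Pr i. \<forall>t. X t \<omega> \<noteq> j" by (simp add: AE_all_countable)
      then have "reach_prob Pr X i {j} = 0"
        unfolding reach_prob_def by (subst law.prob_Collect_eq_0) auto
      then show False using pos by simp
    qed
  qed
  then show ?thesis by (simp add: reach_prob_pos_iff)
qed


subsection \<open>Recurrent classes\<close>

text \<open>The minimum principle on the successors of \<open>i\<close>, with boundary
  \<open>{i}\<close>, shows that each of them hits \<open>i\<close> almost surely; the return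
  probability is then a row sum.\<close>

lemma recurrent_if_always_reachable:
  assumes "\<And>k. (i, k) \<in> (edges P)\<^sup>* \<Longrightarrow> (k, i) \<in> (edges P)\<^sup>*"
  shows "i \<in> recurrent_states Pr X"
proof -
  have one: "reach_prob Pr X k {i} = 1" if "(i, k) \<in> (edges P)\<^sup>*" for k
  proof (rule order_antisym[OF reach_prob_le_1])
    show "1 \<le> reach_prob Pr X k {i}"
    proof (rule harmonic_ge_boundary[OF st, where S = "(edges P)\<^sup>* `` {i}" and C = "{i}"
          and g = "\<lambda>k. reach_prob Pr X k {i}"])
      show "reach_prob Pr X k {i} = (\<Sum>j\<in>UNIV. P $ k $ j * reach_prob Pr X j {i})"
        if "k \<notin> {i}" for k
        using that by (rule reach_prob_harmonic)
    qed (use assms that in \<open>auto simp: reach_prob_start intro: rtrancl_into_rtrancl\<close>)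
  qed
  have "P $ i $ k * reach_prob Pr X k {i} = P $ i $ k" for k
    using one[of k] stochastic_nonedge[OF st, of i k] by (cases "(i, k) \<in> edges P") auto
  then have "return_prob Pr X i = 1"
    by (simp only: return_prob_eq stochastic_row_sum[OF st])
  then show ?thesis by (simp add: recurrent_states_def)
qed

text \<open>If the return is certain, the probability of hitting \<open>{i}\<close> is harmonic at
  \<open>i\<close> as well, so its maximal value 1 spreads from \<open>i\<close> to all
  successors.\<close>

lemma recurrent_imp_always_reachable:
  assumes i: "i \<in> recurrent_states Pr X" and ik: "(i, k) \<in> (edges P)\<^sup>*"
  shows "(k, i) \<in> (edges P)\<^sup>*"
proof -
  have harm: "reach_prob Pr X l {i} = (\<Sum>j\<in>UNIV. P $ l $ j * reach_prob Pr X j {i})" for l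
  proof (cases "l = i")
    case True
    then show ?thesis using i return_prob_eq[of i]
      by (simp add: recurrent_states_def reach_prob_start)
  qed (simp add: reach_prob_harmonic)
  have "reach_prob Pr X k {i} = 1"
    using ik
  proof (induction rule: rtrancl_induct)
    case base
    show ?case by (simp add: reach_prob_start)
  next
    case (step y z)
    \<comment> \<open>Negation turns the upper bound 1 into the lower bound that
      \<open>average_at_lower_bound\<close> expects.\<close>
    have "- reach_prob Pr X z {i} = - 1"
      by (rule average_at_lower_bound[OF st _ _ step.hyps(2)])
        (use harm[of y] step.IH in \<open>auto simp: sum_negf reach_prob_le_1\<close>)
    then show ?case by simp
  qed
  then show ?thesis using reach_prob_pos_iff[of k "{i}"] by simp
qed

lemma recurrent_iff:
  "i \<in> recurrent_states Pr X \<longleftrightarrow>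
    (\<forall>k. (i, k) \<in> (edges P)\<^sup>* \<longrightarrow> (k, i) \<in> (edges P)\<^sup>*)"
  using recurrent_if_always_reachable recurrent_imp_always_reachable by blast

lemma communicating_class_recurrent:
  "i \<in> recurrent_states Pr X \<Longrightarrow> communicating_class Pr X i = (edges P)\<^sup>* `` {i}"
  by (auto simp: communicating_class_def leads_to_iff recurrent_iff)

lemma recurrent_class_subset:
  assumes "C \<in> recurrent_classes Pr X"
  shows "C \<subseteq> recurrent_states Pr X" "C \<noteq> {}"
proof -
  obtain i where i: "i \<in> recurrent_states Pr X" "C = (edges P)\<^sup>* `` {i}"
    using assms by (auto simp: recurrent_classes_def communicating_class_recurrent)
  then show "C \<noteq> {}" by auto
  show "C \<subseteq> recurrent_states Pr X"
  proof
    fix k assume "k \<in> C"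
    then have ik: "(i, k) \<in> (edges P)\<^sup>*" using i by simp
    have "(l, k) \<in> (edges P)\<^sup>*" if "(k, l) \<in> (edges P)\<^sup>*" for l
      using recurrent_imp_always_reachable[OF i(1) rtrancl_trans[OF ik that]] ik
      by (rule rtrancl_trans)
    then show "k \<in> recurrent_states Pr X" by (rule recurrent_if_always_reachable)
  qed
qed

text \<open>A recurrent \<open>k\<close> that can reach \<open>C\<close> can be reached back from
  there, and \<open>C\<close> contains all successors of its members.\<close>

lemma reach_prob_recurrent:
  assumes C: "C \<in> recurrent_classes Pr X" and k: "k \<in> recurrent_states Pr X"
  shows "reach_prob Pr X k C = (if k \<in> C then 1 else 0)"
proof (cases "k \<in> C")
  case False
  obtain i where i: "i \<in> recurrent_states Pr X" "C = (edges P)\<^sup>* `` {i}"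
    using C by (auto simp: recurrent_classes_def communicating_class_recurrent)
  have "\<not> 0 < reach_prob Pr X k C"
  proof
    assume "0 < reach_prob Pr X k C"
    then obtain l where l: "l \<in> C" "(k, l) \<in> (edges P)\<^sup>*" by (auto simp: reach_prob_pos_iff)
    then have "(i, k) \<in> (edges P)\<^sup>*"
      using recurrent_imp_always_reachable[OF k l(2)] i(2) by (auto intro: rtrancl_trans)
    then show False using False i by simp
  qed
  then show ?thesis using False by (simp add: reach_prob_def zero_less_measure_iff)
qed (simp add: reach_prob_start)

text \<open>Among the states reachable from \<open>i\<close>, one with the fewest successors is
  recurrent: each of its successors has the same successor set, hence leads back.\<close>

lemma reaches_recurrent: "\<exists>k\<in>recurrent_states Pr X. (i, k) \<in> (edges P)\<^sup>*"
proof -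
  let ?R = "\<lambda>k. (edges P)\<^sup>* `` {k}"
  obtain k where k: "(i, k) \<in> (edges P)\<^sup>*"
    and min: "\<And>l. (i, l) \<in> (edges P)\<^sup>* \<Longrightarrow> card (?R k) \<le> card (?R l)"
    using ex_has_least_nat[of "\<lambda>l. (i, l) \<in> (edges P)\<^sup>*" i "\<lambda>k. card (?R k)"] by auto
  have "(l, k) \<in> (edges P)\<^sup>*" if "(k, l) \<in> (edges P)\<^sup>*" for l
  proof -
    have "?R l \<subseteq> ?R k" using that by (auto intro: rtrancl_trans)
    moreover have "card (?R k) \<le> card (?R l)" using min k that by (meson rtrancl_trans)
    ultimately have "?R l = ?R k" by (intro card_seteq) auto
    then show ?thesis by auto
  qed
  then have "k \<in> recurrent_states Pr X" by (rule recurrent_if_always_reachable)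
  then show ?thesis using k by blast
qed

lemma transient_states_eq: "transient_states Pr X = - recurrent_states Pr X"
proof -
  have "return_prob Pr X i \<le> 1" for i by (simp add: return_prob_def)
  then show ?thesis
    by (auto simp: transient_states_def recurrent_states_def order_less_le)
qed

lemma exits_transient: "\<exists>k. k \<notin> transient_states Pr X \<and> (i, k) \<in> (edges P)\<^sup>*"
  using reaches_recurrent[of i] by (auto simp: transient_states_eq)

text \<open>Transient states lie outside \<open>C\<close>, so the harmonic equation holds at each of
  them. The right-hand side is integral, as Cramer's rule will require.\<close>

lemma dirichlet_reach_prob:
  assumes C: "C \<in> recurrent_classes Pr X"
  shows "dirichlet_matrix P (transient_states Pr X) *v (\<chi> i. reach_prob Pr X i C) =
    (\<chi> i. if i \<in> C then 1 else 0)"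
  using reach_prob_harmonic[of _ C] recurrent_class_subset(1)[OF C]
  by (auto simp: vec_eq_iff dirichlet_matrix_vector transient_states_eq reach_prob_recurrent[OF C])

lemma reach_prob_unique_recurrent_state:
  assumes "recurrent_states Pr X = {r}" "C \<in> recurrent_classes Pr X"
  shows "reach_prob Pr X i C = 1"
proof (rule order_antisym[OF reach_prob_le_1])
  have [simp]: "C = {r}" using recurrent_class_subset[OF assms(2)] assms(1) by auto
  show "1 \<le> reach_prob Pr X i C"
    by (rule harmonic_ge_boundary[OF st, where S = UNIV and C = "{r}"
        and g = "\<lambda>i. reach_prob Pr X i C"])
      (use reaches_recurrent assms(1) in \<open>auto simp: reach_prob_start intro: reach_prob_harmonic\<close>)
qed

end


subsection \<open>Denominators\<close>

text \<open>Ensures that the \<open>LEAST\<close> in \<open>lowest_common_denominator\<close> has a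
  witness.\<close>

lemma finite_rats_common_denominator:
  fixes A :: "real set"
  assumes "finite A" "A \<subseteq> \<rat>"
  shows "\<exists>d::nat. d > 0 \<and> (\<forall>x\<in>A. of_nat d * x \<in> \<int>)"
  using assms
proof (induction A rule: finite_induct)
  case empty
  show ?case by (intro exI[of _ 1]) simp
next
  case (insert a A)
  then obtain d :: nat where d: "d > 0" "\<forall>x\<in>A. of_nat d * x \<in> \<int>" by auto
  obtain m n where "a = of_int m / of_int n" "n > 0"
    using insert.prems Rats_cases'[of a] by (metis insert_subset)
  then have mn: "a = of_int m / real (nat n)" "nat n > 0" by simp_all
  show ?case
  proof (intro exI[of _ "d * nat n"] conjI ballI)
    show "0 < d * nat n" using d mn by simp
    fix x assume "x \<in> insert a A"
    then consider "x = a" | "x \<in> A" by blast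
    then show "real (d * nat n) * x \<in> \<int>"
    proof cases
      case 1
      then have "real (d * nat n) * x = of_nat d * of_int m" using mn by simp
      then show ?thesis by (simp only: Ints_mult Ints_of_nat Ints_of_int)
    next
      case 2
      have "real (d * nat n) * x = of_nat (nat n) * (of_nat d * x)" by simp
      then show ?thesis using d 2 by (simp only: Ints_mult Ints_of_nat)
    qed
  qed
qed

lemma lowest_common_denominator:
  assumes "finite A" "A \<subseteq> \<rat>"
  shows "0 < lowest_common_denominator A"
    and "x \<in> A \<Longrightarrow> of_nat (lowest_common_denominator A) * x \<in> \<int>"
  using LeastI_ex[OF finite_rats_common_denominator[OF assms]]
  by (auto simp: lowest_common_denominator_def)

lemma lowest_common_denominator_le:
  assumes "d > 0" "\<And>x. x \<in> A \<Longrightarrow> of_nat d * x \<in> \<int>"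
  shows "lowest_common_denominator A \<le> d"
  unfolding lowest_common_denominator_def by (rule Least_le) (use assms in auto)

lemma Ints_det:
  fixes A :: "real^'n^'n"
  assumes "\<And>i j. A $ i $ j \<in> \<int>"
  shows "det A \<in> \<int>"
  unfolding det_def by (intro Ints_sum Ints_mult Ints_prod assms) simp

text \<open>By Cramer's rule the product is the determinant of \<open>A\<close> with column
  \<open>k\<close> replaced by \<open>A *v x\<close>, an integral matrix.\<close>

lemma Ints_cramer:
  fixes A :: "real^'n^'n"
  assumes "\<And>i j. A $ i $ j \<in> \<int>" "\<And>i. (A *v x) $ i \<in> \<int>"
  shows "det A * x $ k \<in> \<int>"
proof -
  have "det (\<chi> i j. if j = k then (A *v x) $ i else A $ i $ j) \<in> \<int>"
    by (rule Ints_det) (use assms in auto)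
  then show ?thesis by (simp add: cramer_lemma mult.commute)
qed

context
  fixes P :: "real^'n^'n"
  assumes rat: "\<And>i j. P $ i $ j \<in> \<rat>"
begin

lemma finite_entries: "finite {P $ i $ j | i j. True}"
proof -
  have "{P $ i $ j | i j. True} = (\<lambda>(i, j). P $ i $ j) ` UNIV" by auto
  then show ?thesis by simp
qed

lemma row_denominator:
  "0 < row_denominator P i" "of_nat (row_denominator P i) * P $ i $ j \<in> \<int>"
proof -
  have *: "finite {P $ i $ j | j. True}" "{P $ i $ j | j. True} \<subseteq> \<rat>"
    using rat by (auto simp: full_SetCompr_eq)
  show "0 < row_denominator P i" "of_nat (row_denominator P i) * P $ i $ j \<in> \<int>"
    unfolding row_denominator_def by (rule lowest_common_denominator[OF *], rule lowest_common_denominator[OF *], blast)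
qed

lemma matrix_denominator:
  "0 < matrix_denominator P" "of_nat (matrix_denominator P) * P $ i $ j \<in> \<int>"
proof -
  have *: "{P $ i $ j | i j. True} \<subseteq> \<rat>" using rat by auto
  show "0 < matrix_denominator P" "of_nat (matrix_denominator P) * P $ i $ j \<in> \<int>"
    unfolding matrix_denominator_def
    by (rule lowest_common_denominator[OF finite_entries *],
        rule lowest_common_denominator[OF finite_entries *], blast)
qed

lemma row_denominator_le: "row_denominator P i \<le> matrix_denominator P"
  unfolding row_denominator_def
  by (rule lowest_common_denominator_le) (auto intro: matrix_denominator)

lemma det_scaled_dirichlet_matrix:
  "det (\<chi> i. (if i \<in> S then real (row_denominator P i) else 1) *s dirichlet_matrix P S $ i) =
    real (\<Prod>i\<in>S. row_denominator P i) * det (dirichlet_matrix P S)"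
  by (subst det_rows_mul) (simp add: prod.If_cases)

text \<open>Scaling the rows in \<open>S\<close> by their denominators makes the system integral;
  the other rows are rows of the identity. The second claim makes the factor an integer, so that it
  can serve as a denominator.\<close>

lemma dirichlet_solution_denominator:
  assumes "\<And>i. (dirichlet_matrix P S *v x) $ i \<in> \<int>"
  shows "real (\<Prod>i\<in>S. row_denominator P i) * det (dirichlet_matrix P S) * x $ k \<in> \<int>"
    and "real (\<Prod>i\<in>S. row_denominator P i) * det (dirichlet_matrix P S) \<in> \<int>"
proof -
  let ?c = "\<lambda>i. if i \<in> S then real (row_denominator P i) else 1"
  let ?B = "\<chi> i. ?c i *s dirichlet_matrix P S $ i"
  have int: "?B $ i $ j \<in> \<int>" for i j
    using row_denominator(2)[of i j] by (auto simp: dirichlet_matrix_def right_diff_distrib)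
  have "(?B *v x) $ i = ?c i * (dirichlet_matrix P S *v x) $ i" for i
    by (simp add: matrix_vector_mult_def sum_distrib_left mult.assoc)
  then have "(?B *v x) $ i \<in> \<int>" for i
    using assms[of i] by simp
  then have "det ?B * x $ k \<in> \<int>" by (rule Ints_cramer[OF int])
  then show "real (\<Prod>i\<in>S. row_denominator P i) * det (dirichlet_matrix P S) * x $ k \<in> \<int>"
    by (simp only: det_scaled_dirichlet_matrix)
  show "real (\<Prod>i\<in>S. row_denominator P i) * det (dirichlet_matrix P S) \<in> \<int>"
    using Ints_det[OF int] by (simp only: det_scaled_dirichlet_matrix)
qed

end

theorem theorem1p3:
  fixes P :: "real^'n^'n"
    and Pr :: "'n \<Rightarrow> 'w measure"
    and X :: "nat \<Rightarrow> 'w \<Rightarrow> 'n"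
  assumes "stochastic_matrix P"
    and "\<forall>i j. P $ i $ j \<in> \<rat>"
    and "markov_chain_started_at_each Pr X P"
  shows "(\<forall>i. \<forall>C\<in>recurrent_classes Pr X. reach_prob Pr X i C \<in> \<rat>) \<and>
         real (lowest_common_denominator {reach_prob Pr X i C | i C. C \<in> recurrent_classes Pr X})
           \<le> min (real (\<Prod>i\<in>transient_states Pr X. row_denominator P i))
                 (real (matrix_denominator P) powi (int CARD('n) - 2))"
proof -
  interpret markov_family P Pr X by unfold_locales (rule assms)+
  have rat: "P $ i $ j \<in> \<rat>" for i j using assms(2) by blast
  let ?T = "transient_states Pr X" and ?M = "matrix_denominator P"
  let ?A = "{reach_prob Pr X i C | i C. C \<in> recurrent_classes Pr X}"
  define D where "D = (\<Prod>i\<in>?T. row_denominator P i)"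
  have "D > 0" unfolding D_def by (intro prod_pos row_denominator rat)
  note det = det_dirichlet_matrix_le_1[OF st exits_transient]
  \<comment> \<open>Integrality of the determinant does not involve the solution, so the zero vector
    is inserted for it.\<close>
  have "real D * det (dirichlet_matrix P ?T) \<in> \<int>"
    unfolding D_def using dirichlet_solution_denominator(2)[OF rat, of ?T 0] by simp
  then obtain d :: int where d: "of_int d = real D * det (dirichlet_matrix P ?T)"
    by (auto elim!: Ints_cases)
  have "0 < real D * det (dirichlet_matrix P ?T)" using \<open>D > 0\<close> det by simp
  then have "d > 0" using d by linarith
  have d_le: "real_of_int d \<le> D" using d det by (simp add: mult_left_le)
  have d_int: "of_int d * reach_prob Pr X i C \<in> \<int>" if "C \<in> recurrent_classes Pr X" for i C
    using dirichlet_solution_denominator(1)[OF rat, of ?T "\<chi> i. reach_prob Pr X i C" i]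
    by (simp add: d D_def dirichlet_reach_prob[OF that])
  have "reach_prob Pr X i C \<in> \<rat>" if C: "C \<in> recurrent_classes Pr X" for i C
  proof -
    obtain m where "of_int d * reach_prob Pr X i C = of_int m"
      using d_int[OF C] by (auto elim!: Ints_cases)
    then have "reach_prob Pr X i C = of_int m / of_int d"
      using \<open>d > 0\<close> by (simp add: field_simps)
    then show ?thesis by simp
  qed
  moreover have "lowest_common_denominator ?A \<le> nat d"
    by (rule lowest_common_denominator_le) (use \<open>d > 0\<close> d_int in auto)
  then have le_D: "real (lowest_common_denominator ?A) \<le> real D"
    using d_le \<open>d > 0\<close> by linarith
  \<comment> \<open>With one recurrent state \<open>?T\<close> has \<open>CARD('n) - 1\<close>
    elements and bounding \<open>D\<close> gives an exponent one too large; the common denominator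
    is then 1 instead.\<close>
  moreover have "real (lowest_common_denominator ?A) \<le> real ?M powi (int CARD('n) - 2)"
  proof (cases "card (recurrent_states Pr X) \<ge> 2")
    case True
    have card: "card ?T + card (recurrent_states Pr X) = CARD('n)"
      unfolding transient_states_eq Compl_eq_Diff_UNIV by (simp add: card_Diff_subset card_mono)
    have "D \<le> (\<Prod>i\<in>?T. ?M)"
      unfolding D_def by (intro prod_mono) (auto intro: row_denominator_le rat)
    also have "\<dots> = ?M ^ card ?T" by simp
    also have "\<dots> \<le> ?M ^ (CARD('n) - 2)"
      using matrix_denominator(1)[OF rat] True card by (intro power_increasing) auto
    finally have "real D \<le> real ?M ^ (CARD('n) - 2)"
      by (metis of_nat_le_iff of_nat_power)
    \<comment> \<open>Two recurrent states force \<open>CARD('n) \<ge> 2\<close>, so natural and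
      integer subtraction agree.\<close>
    also have "\<dots> = real ?M powi (int CARD('n) - 2)"
      using True card by (simp add: power_int_def nat_diff_distrib)
    finally show ?thesis using le_D by simp
  next
    case False
    have "recurrent_states Pr X \<noteq> {}" using reaches_recurrent by blast
    then have "0 < card (recurrent_states Pr X)" by (simp add: card_gt_0_iff)
    then have "card (recurrent_states Pr X) = 1" using False by linarith
    then obtain r where r: "recurrent_states Pr X = {r}" by (auto simp: card_1_singleton_iff)
    have "lowest_common_denominator ?A \<le> 1"
      by (rule lowest_common_denominator_le) (auto simp: reach_prob_unique_recurrent_state[OF r])
    moreover have "1 \<le> real ?M powi (int CARD('n) - 2)"
    \<comment> \<open>For a single state the exponent is \<open>-1\<close>, and the bound holds
      because the only entry is 1, so that \<open>?M = 1\<close>.\<close>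
    proof (cases "CARD('n) = 1")
      case True
      then obtain a where a: "(UNIV :: 'n set) = {a}" by (auto simp: card_1_singleton_iff)
      have "P $ a $ a = 1"
        using stochastic_row_sum[OF st, of a] unfolding a by simp
      moreover have "i = a" for i using a by blast
      ultimately have "P $ i $ j = 1" for i j by metis
      then have "?M \<le> 1"
        unfolding matrix_denominator_def by (intro lowest_common_denominator_le) auto
      then have "?M = 1" using matrix_denominator(1)[OF rat] by linarith
      then show ?thesis by simp
    next
      case False
      moreover have "CARD('n) > 0" by simp
      ultimately have "int CARD('n) - 2 \<ge> 0" by linarith
      then show ?thesis
        using matrix_denominator(1)[OF rat] by (simp add: power_int_def one_le_power)
    qed
    ultimately show ?thesis by linarith
  qed
  ultimately show ?thesis by (simp add: D_def)
qed

end
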